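(* Let $\mathbf{k}$ be a field, $n\in\mathbb{N}$, and $\lambda_1,\lambda_2,\ldots,\lambda_n\in\mathbf{k}$. For each $i\in[f_{n+1}]$, let $\delta_i$ be the number of all permutations $w\in S_n$ satisfying $\operatorname{Qind}w=i$, and set $$g_i:=\lambda_1m_{Q_i,1}+\lambda_2m_{Q_i,2}+\cdots+\lambda_nm_{Q_i,n}=\sum_{\ell=1}^n\lambda_\ell m_{Q_i,\ell}\in\mathbf{k}.$$ Let $\kappa\in\mathbf{k}$. Then the algebraic multiplicity of $\kappa$ as an eigenvalue of $R(\lambda_1t_1+\lambda_2t_2+\cdots+\lambda_nt_n)$ equals $$\sum_{\substack{i\in[f_{n+1}];\\ g_i=\kappa}}\delta_i.$$
   Context: $\mathbb{N}=\{0,1,2,\ldots\}$; $[m]=\{1,\ldots,m\}$ (empty if $m\le 0$). $S_n$ is the group of permutations of $[n]$, with product $(\pi\sigma)(i)=\pi(\sigma(i))$; $\mathbf{k}[S_n]$ is its group algebra. For distinct $i_1,\ldots,i_k\in[n]$, $\operatorname{cyc}_{i_1,\ldots,i_k}\in S_n$ sends $i_1,\ldots,i_{k-1},i_k$ to $i_2,\ldots,i_k,i_1$, respectively, and fixes all other elements. For $\ell\in[n]$, $t_\ell:=\operatorname{cyc}_\ell+\operatorname{cyc}_{\ell,\ell+1}+\cdots+\operatorname{cyc}_{\ell,\ell+1,\ldots,n}\in\mathbf{k}[S_n]$. For $x\in\mathbf{k}[S_n]$, $R(x):\mathbf{k}[S_n]\to\mathbf{k}[S_n]$ is the $\mathbf{k}$-linear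 map $y\mapsto yx$. For $w\in S_n$, $\operatorname{Des}w:=\{i\in[n-1]\mid w(i)>w(i+1)\}$. Fibonacci numbers: $f_0=0$, $f_1=1$, $f_m=f_{m-1}+f_{m-2}$. A set of integers is lacunar if it contains no two consecutive integers. For a finite set $I$ of integers, $\operatorname{sum}I$ is the sum of its elements. There are exactly $f_{n+1}$ lacunar subsets of $[n-1]$; fix a listing $Q_1,Q_2,\ldots,Q_{f_{n+1}}$ of all of them, without repetition, such that $\operatorname{sum}(Q_1)\le\cdots\le\operatorname{sum}(Q_{f_{n+1}})$. For $I\subseteq[n]$: $\widehat I:=\{0\}\cup I\cup\{n+1\}$; $m_{I,\ell}:=(\text{smallest element of }\widehat I\text{ that is}\ge\ell)-\ell$ for $\ell\in[n]$; $I':=\{i\in[n-1]\mid i\notin I\text{ and }i+1\notin I\}$. For $w\in S_n$, $\operatorname{Qind}w$ is the smallest $i\in[f_{n+1}]$ such that $Q_i'\subseteq\operatorname{Des}w$ (such an $i$ always exists). The algebraic multiplicity of $\kappa$ is its multiplicity as a root of the characteristic polynomial ($0$ if it is not an eigenvalue). *)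

theory Defs
  imports
    "Jordan_Normal_Form.Char_Poly"
    "HOL-Combinatorics.Permutations"
    "HOL-Combinatorics.Cycles"
    "HOL-Number_Theory.Fib"
    "HOL-Library.Function_Algebras"
begin

section \<open>Characteristic polynomial of an endomorphism of a finite-dimensional space\<close>

locale endo_space = vector_space scale
  for scale :: "'a::field \<Rightarrow> 'b::ab_group_add \<Rightarrow> 'b" (infixr "*s" 75)
begin

definition ordered_basis :: "'b set \<Rightarrow> 'b list \<Rightarrow> bool" where
  "ordered_basis V bs \<longleftrightarrow> distinct bs \<and> independent (set bs) \<and> span (set bs) = V"

definition matrix_wrt :: "'b list \<Rightarrow> ('b \<Rightarrow> 'b) \<Rightarrow> 'a mat" where
  "matrix_wrt bs F = mat (length bs) (length bs)
     (\<lambda>(i, j). representation (set bs) (F (bs ! j)) (bs ! i))"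

text \<open>The choice of basis is immaterial, see \<open>endo_char_poly_eq\<close> below.\<close>

definition endo_char_poly :: "'b set \<Rightarrow> ('b \<Rightarrow> 'b) \<Rightarrow> 'a poly" where
  "endo_char_poly V F = char_poly (matrix_wrt (SOME bs. ordered_basis V bs) F)"

definition alg_multiplicity :: "'b set \<Rightarrow> ('b \<Rightarrow> 'b) \<Rightarrow> 'a \<Rightarrow> nat" where
  "alg_multiplicity V F \<kappa> = Polynomial.order \<kappa> (endo_char_poly V F)"

lemma ordered_basis_expand:
  assumes "ordered_basis V bs" "v \<in> V"
  shows "v = (\<Sum>k<length bs. representation (set bs) v (bs ! k) *s bs ! k)"
proof -
  have "bij_betw ((!) bs) {..<length bs} (set bs)"
    using assms(1) by (simp add: ordered_basis_def bij_betw_nth)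
  then have "(\<Sum>k<length bs. representation (set bs) v (bs ! k) *s bs ! k)
      = (\<Sum>b\<in>set bs. representation (set bs) v b *s b)"
    by (rule sum.reindex_bij_betw)
  also have "\<dots> = v"
    using assms by (intro sum_representation_eq) (auto simp: ordered_basis_def)
  finally show ?thesis by simp
qed

lemma ordered_basis_length:
  assumes "ordered_basis V bs" "ordered_basis V cs"
  shows "length bs = length cs"
proof -
  have "dim V = length bs" "dim V = length cs"
    using assms dim_eq_card[of "set bs" V] dim_eq_card[of "set cs" V]
    by (auto simp: ordered_basis_def distinct_card span_span)
  then show ?thesis by simp
qed

lemma representation_linear_expand:
  assumes bs: "ordered_basis V bs" and cs: "ordered_basis V cs"
    and F: "\<And>x. x \<in> V \<Longrightarrow> F x \<in> V"
    and add: "\<And>x y. x \<in> V \<Longrightarrow> y \<in> V \<Longrightarrow> F (x + y) = F x + F y"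
    and sc: "\<And>a x. x \<in> V \<Longrightarrow> F (a *s x) = a *s F x"
    and v: "v \<in> V"
  shows "representation (set bs) (F v) b =
    (\<Sum>k<length cs. representation (set bs) (F (cs ! k)) b * representation (set cs) v (cs ! k))"
proof -
  have V: "subspace V" using cs by (auto simp: ordered_basis_def)
  have csV: "cs ! k \<in> V" if "k < length cs" for k
    using cs that by (auto simp: ordered_basis_def intro: span_base)
  have F0: "F 0 = 0" using sc[OF subspace_0[OF V], of 0] by simp
  have Fsum: "F (\<Sum>k\<in>A. c k *s cs ! k) = (\<Sum>k\<in>A. c k *s F (cs ! k)) \<and> (\<Sum>k\<in>A. c k *s cs ! k) \<in> V"
    if "finite A" "A \<subseteq> {..<length cs}" for A c
    using that
  proof (induction A)
    case empty
    then show ?case using F0 subspace_0[OF V] by simp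
  next
    case (insert k A)
    then show ?case
      using csV[of k] by (auto simp: add sc subspace_add[OF V] subspace_scale[OF V])
  qed
  have ind: "independent (set bs)" and sp: "span (set bs) = V"
    using bs by (auto simp: ordered_basis_def)
  let ?c = "\<lambda>k. representation (set cs) v (cs ! k)"
  have "F v = F (\<Sum>k<length cs. ?c k *s cs ! k)"
    using ordered_basis_expand[OF cs v] by simp
  also have "\<dots> = (\<Sum>k<length cs. ?c k *s F (cs ! k))"
    using Fsum[of "{..<length cs}" ?c] by simp
  finally have Fv: "F v = (\<Sum>k<length cs. ?c k *s F (cs ! k))" .
  have "representation (set bs) (F v) = (\<lambda>b. \<Sum>k<length cs. representation (set bs) (?c k *s F (cs ! k)) b)"
    unfolding Fv
    using F csV sp subspace_scale[OF V] by (intro representation_sum[OF ind]) auto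
  moreover have "representation (set bs) (?c k *s F (cs ! k)) b
      = ?c k * representation (set bs) (F (cs ! k)) b" if "k < length cs" for k
    using representation_scale[OF ind, of "F (cs ! k)" "?c k"] F csV[OF that] sp by auto
  ultimately show ?thesis by (simp add: mult.commute)
qed

lemma endo_char_poly_eq:
  assumes bs: "ordered_basis V bs"
    and F: "\<And>x. x \<in> V \<Longrightarrow> F x \<in> V"
    and add: "\<And>x y. x \<in> V \<Longrightarrow> y \<in> V \<Longrightarrow> F (x + y) = F x + F y"
    and sc: "\<And>a x. x \<in> V \<Longrightarrow> F (a *s x) = a *s F x"
  shows "endo_char_poly V F = char_poly (matrix_wrt bs F)"
proof -
  define cs where "cs = (SOME cs. ordered_basis V cs)"
  have cs: "ordered_basis V cs" unfolding cs_def using bs by (rule someI)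
  define N where "N = length bs"
  have len: "length cs = N" using ordered_basis_length[OF bs cs] by (simp add: N_def)
  define M where "M = (\<lambda>(bs :: 'b list) (cs :: 'b list) G. mat N N (\<lambda>(i, j). representation (set bs) (G (cs ! j)) (bs ! i)))"
  have prod: "M p q G * M q r H = M p r (\<lambda>x. G (H x))"
    if p: "ordered_basis V p" "length p = N" and q: "ordered_basis V q" "length q = N"
      and r: "ordered_basis V r" "length r = N"
      and G: "\<And>x. x \<in> V \<Longrightarrow> G x \<in> V" "\<And>x y. x \<in> V \<Longrightarrow> y \<in> V \<Longrightarrow> G (x + y) = G x + G y"
        "\<And>a x. x \<in> V \<Longrightarrow> G (a *s x) = a *s G x"
      and H: "\<And>x. x \<in> V \<Longrightarrow> H x \<in> V" for p q r G H
  proof (rule eq_matI)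
    fix i j assume "i < dim_row (M p r (\<lambda>x. G (H x)))" "j < dim_col (M p r (\<lambda>x. G (H x)))"
    then have ij: "i < N" "j < N" by (auto simp: M_def)
    have "r ! j \<in> V" using r ij by (auto simp: ordered_basis_def intro: span_base)
    then show "(M p q G * M q r H) $$ (i, j) = M p r (\<lambda>x. G (H x)) $$ (i, j)"
      using ij representation_linear_expand[OF p(1) q(1) G H, of "r ! j" "p ! i"] q(2)
      by (simp add: M_def scalar_prod_def atLeast0LessThan)
  qed (auto simp: M_def)
  have one: "M p p (\<lambda>x. x) = 1\<^sub>m N" if p: "ordered_basis V p" "length p = N" for p
  proof (rule eq_matI)
    fix i j assume "i < dim_row (1\<^sub>m N :: 'a mat)" "j < dim_col (1\<^sub>m N :: 'a mat)"
    then have ij: "i < N" "j < N" by auto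
    have "representation (set p) (p ! j) = (\<lambda>b. if b = p ! j then 1 else 0)"
      using p ij by (intro representation_basis) (auto simp: ordered_basis_def)
    then show "M p p (\<lambda>x. x) $$ (i, j) = 1\<^sub>m N $$ (i, j)"
      using ij p by (simp add: M_def ordered_basis_def nth_eq_iff_index_eq)
  qed (auto simp: M_def)
  have "similar_mat (M cs cs F) (M bs bs F)"
  proof (rule similar_matI)
    show "{M cs cs F, M bs bs F, M cs bs (\<lambda>x. x), M bs cs (\<lambda>x. x)} \<subseteq> carrier_mat N N"
      by (auto simp: M_def)
    show "M cs bs (\<lambda>x. x) * M bs cs (\<lambda>x. x) = 1\<^sub>m N" "M bs cs (\<lambda>x. x) * M cs bs (\<lambda>x. x) = 1\<^sub>m N"
      using bs cs len one by (simp_all add: prod N_def[symmetric])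
    show "M cs cs F = M cs bs (\<lambda>x. x) * M bs bs F * M bs cs (\<lambda>x. x)"
      using bs cs len F add sc by (simp add: prod N_def[symmetric])
  qed
  then have "char_poly (M cs cs F) = char_poly (M bs bs F)" by (rule char_poly_similar)
  then show ?thesis
    by (simp add: endo_char_poly_def matrix_wrt_def M_def cs_def[symmetric] len N_def[symmetric])
qed

end

section \<open>The group algebra of the symmetric group\<close>

text \<open>
  An element of \<open>k[S\<^sub>n]\<close> is a coefficient function on \<open>nat \<Rightarrow> nat\<close> vanishing outside
  \<open>S\<^sub>n\<close>. Its additive structure is the pointwise one; its product is
  \<open>ga_mult\<close>, not the pointwise \<open>*\<close> on functions.
\<close>

abbreviation Sym :: "nat \<Rightarrow> (nat \<Rightarrow> nat) set" where
  "Sym n \<equiv> {w. w permutes {1..n}}"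

definition group_algebra :: "nat \<Rightarrow> ((nat \<Rightarrow> nat) \<Rightarrow> 'a::field) set" where
  "group_algebra n = {x. \<forall>w. w \<notin> Sym n \<longrightarrow> x w = 0}"

definition ga_scale :: "'a::field \<Rightarrow> ((nat \<Rightarrow> nat) \<Rightarrow> 'a) \<Rightarrow> (nat \<Rightarrow> nat) \<Rightarrow> 'a" where
  "ga_scale c x = (\<lambda>w. c * x w)"

definition ga_perm :: "(nat \<Rightarrow> nat) \<Rightarrow> (nat \<Rightarrow> nat) \<Rightarrow> 'a::field" where
  "ga_perm u = (\<lambda>w. if w = u then 1 else 0)"

definition ga_mult ::
    "nat \<Rightarrow> ((nat \<Rightarrow> nat) \<Rightarrow> 'a::field) \<Rightarrow> ((nat \<Rightarrow> nat) \<Rightarrow> 'a) \<Rightarrow> (nat \<Rightarrow> nat) \<Rightarrow> 'a" where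
  "ga_mult n x y = (\<lambda>w. \<Sum>(u, v) \<in> {(u, v). u \<in> Sym n \<and> v \<in> Sym n \<and> u \<circ> v = w}. x u * y v)"

definition right_mult ::
    "nat \<Rightarrow> ((nat \<Rightarrow> nat) \<Rightarrow> 'a::field) \<Rightarrow> ((nat \<Rightarrow> nat) \<Rightarrow> 'a) \<Rightarrow> (nat \<Rightarrow> nat) \<Rightarrow> 'a" where
  "right_mult n x = (\<lambda>y. ga_mult n y x)"

global_interpretation ga: endo_space "ga_scale :: 'a::field \<Rightarrow> ((nat \<Rightarrow> nat) \<Rightarrow> 'a) \<Rightarrow> _"
  by unfold_locales (auto simp: ga_scale_def algebra_simps)

lemma sum_ga_apply: "(\<Sum>u\<in>A. f u) w = (\<Sum>u\<in>A. f u w)"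
  for f :: "'b \<Rightarrow> (nat \<Rightarrow> nat) \<Rightarrow> 'a::field"
  by (induction A rule: infinite_finite_induct) auto

lemma inj_ga_perm: "inj (ga_perm :: _ \<Rightarrow> _ \<Rightarrow> 'a::field)"
  by (auto simp: inj_def ga_perm_def fun_eq_iff split: if_splits)

lemma ga_standard_basis:
  assumes "distinct ws" "set ws = Sym n"
  shows "ga.ordered_basis (group_algebra n) (map (ga_perm :: _ \<Rightarrow> _ \<Rightarrow> 'a::field) ws)"
proof -
  let ?p = "ga_perm :: _ \<Rightarrow> _ \<Rightarrow> 'a"
  have fin: "finite (Sym n)" by (simp add: finite_permutations)
  have coeff: "(\<Sum>u\<in>Sym n. ga_scale (c u) (?p u)) w = (if w \<in> Sym n then c w else 0)" for c w
  proof -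
    have "(\<Sum>u\<in>Sym n. ga_scale (c u) (?p u)) w = (\<Sum>u\<in>Sym n. if w = u then c u else 0)"
      by (auto simp: sum_ga_apply ga_scale_def ga_perm_def intro!: sum.cong)
    also have "\<dots> = (if w \<in> Sym n then c w else 0)"
      using sum.delta'[OF fin, of w c] by (simp only: eq_commute)
    finally show ?thesis .
  qed
  have "ga.independent (?p ` Sym n)"
  proof (rule ga.independent_if_scalars_zero)
    fix f x assume s: "(\<Sum>x\<in>?p ` Sym n. ga_scale (f x) x) = 0" and x: "x \<in> ?p ` Sym n"
    from x obtain w where w: "w \<in> Sym n" "x = ?p w" by auto
    have "(\<Sum>u\<in>Sym n. ga_scale (f (?p u)) (?p u)) = 0"
      using s by (simp add: sum.reindex inj_on_subset[OF inj_ga_perm])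
    then show "f x = 0" using coeff[of "\<lambda>u. f (?p u)" w] w by auto
  qed (rule finite_imageI[OF fin])
  moreover have "ga.span (?p ` Sym n) = group_algebra n"
  proof
    have "ga.subspace (group_algebra n :: (_ \<Rightarrow> 'a) set)"
      by (auto simp: ga.subspace_def group_algebra_def ga_scale_def)
    then show "ga.span (?p ` Sym n) \<subseteq> group_algebra n"
      by (intro ga.span_minimal) (auto simp: group_algebra_def ga_perm_def)
    show "group_algebra n \<subseteq> ga.span (?p ` Sym n)"
    proof
      fix x :: "_ \<Rightarrow> 'a" assume "x \<in> group_algebra n"
      then have "x = (\<Sum>u\<in>Sym n. ga_scale (x u) (?p u))"
        by (intro ext) (simp only: coeff, auto simp: group_algebra_def)
      also have "\<dots> \<in> ga.span (?p ` Sym n)"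
        by (intro ga.span_sum ga.span_scale ga.span_base) auto
      finally show "x \<in> ga.span (?p ` Sym n)" .
    qed
  qed
  ultimately show ?thesis
    using assms inj_on_subset[OF inj_ga_perm]
    by (simp add: ga.ordered_basis_def distinct_map)
qed

text \<open>\<open>cycle_of_list [i\<^sub>1, \<dots>, i\<^sub>k]\<close> sends each \<open>i\<^sub>j\<close> to \<open>i\<^sub>j\<^sub>+\<^sub>1\<close> and \<open>i\<^sub>k\<close> to \<open>i\<^sub>1\<close>.\<close>

definition t_elem :: "nat \<Rightarrow> nat \<Rightarrow> (nat \<Rightarrow> nat) \<Rightarrow> 'a::field" where
  "t_elem n l = (\<Sum>m = l..n. ga_perm (cycle_of_list [l..<Suc m]))"

section \<open>Lacunar sets and descents\<close>

definition Des :: "nat \<Rightarrow> (nat \<Rightarrow> nat) \<Rightarrow> nat set" where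
  "Des n w = {i \<in> {1..n - 1}. w i > w (i + 1)}"

definition lacunar :: "nat set \<Rightarrow> bool" where
  "lacunar I \<longleftrightarrow> (\<forall>i. \<not> (i \<in> I \<and> i + 1 \<in> I))"

definition lacunar_listing :: "nat \<Rightarrow> (nat \<Rightarrow> nat set) \<Rightarrow> bool" where
  "lacunar_listing n Q \<longleftrightarrow>
     bij_betw Q {1..fib (n + 1)} {I. I \<subseteq> {1..n - 1} \<and> lacunar I} \<and>
     mono_on {1..fib (n + 1)} (\<lambda>i. \<Sum>(Q i))"

definition hat :: "nat \<Rightarrow> nat set \<Rightarrow> nat set" where
  "hat n I = {0} \<union> I \<union> {n + 1}"

definition m_dist :: "nat \<Rightarrow> nat set \<Rightarrow> nat \<Rightarrow> nat" where
  "m_dist n I l = Min {x \<in> hat n I. x \<ge> l} - l"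

definition nonshadow :: "nat \<Rightarrow> nat set \<Rightarrow> nat set" where
  "nonshadow n I = {i \<in> {1..n - 1}. i \<notin> I \<and> i + 1 \<notin> I}"

definition Qind :: "nat \<Rightarrow> (nat \<Rightarrow> nat set) \<Rightarrow> (nat \<Rightarrow> nat) \<Rightarrow> nat" where
  "Qind n Q w = (LEAST i. i \<in> {1..fib (n + 1)} \<and> nonshadow n (Q i) \<subseteq> Des n w)"

definition delta :: "nat \<Rightarrow> (nat \<Rightarrow> nat set) \<Rightarrow> nat \<Rightarrow> nat" where
  "delta n Q i = card {w \<in> Sym n. Qind n Q w = i}"

definition g_val :: "nat \<Rightarrow> (nat \<Rightarrow> 'a::field) \<Rightarrow> (nat \<Rightarrow> nat set) \<Rightarrow> nat \<Rightarrow> 'a" where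
  "g_val n lam Q i = (\<Sum>l = 1..n. lam l * of_nat (m_dist n (Q i) l))"

end

theory Submission
  imports Defs "HOL-Library.Fun_Lexorder"
begin

text \<open>
The endomorphism is triangular. For \<open>I \<subseteq> [n]\<close> let \<open>F(I)\<close> be the space of all \<open>q\<close> with \<open>q s\<^sub>j = q\<close> for
every \<open>j \<in> I'\<close>, where \<open>s\<^sub>j\<close> is the transposition of \<open>j\<close> and \<open>j + 1\<close>. On \<open>F(I)\<close> every \<open>t\<^sub>l\<close> acts as
the scalar \<open>m\<^sub>I\<^sub>,\<^sub>l\<close>, up to an error in the sum of all \<open>F(J)\<close> with \<open>sum J < sum I\<close>
(\<open>t_act_stable\<close>). Indeed, if \<open>p\<close> is the element of \<open>{0} \<union> I \<union> {n + 1}\<close> that defines \<open>m\<^sub>I\<^sub>,\<^sub>l\<close>, then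
the \<open>p - l\<close> cycles on \<open>l, \<dots>, m\<close> with \<open>m < p\<close> fix \<open>q\<close>; and the cycles with
\<open>m \<ge> p\<close> are grouped according to the largest element \<open>r\<close> of \<open>I\<close> that is at most \<open>m\<close>. Each group
sends \<open>q\<close> into \<open>F(J)\<close>, where \<open>J\<close> arises from \<open>I\<close> by lowering the elements from \<open>p\<close> to \<open>r\<close> by one
(\<open>block_shuffle_in_below\<close>).

Lacunar sets suffice: every \<open>F(J)\<close> is contained in \<open>F(K)\<close> for some lacunar \<open>K \<subseteq> [n - 1]\<close>
with \<open>sum K \<le> sum J\<close> (\<open>lacunar_refinement\<close>). So the listing \<open>Q\<^sub>1, Q\<^sub>2, \<dots>\<close> gives
a filtration with partial sums \<open>F(Q\<^sub>1) + \<dots> + F(Q\<^sub>i)\<close>, on whose \<open>i\<close>-th layer the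
endomorphism acts as the scalar \<open>g\<^sub>i\<close>.

A basis adapted to all \<open>F(I)\<close> at once gives the dimensions. For \<open>w \<in> S\<^sub>n\<close>, let
\<open>a\<^sub>w\<close> be the sum of the coset \<open>w W\<close>, where \<open>W\<close> is generated by the \<open>s\<^sub>j\<close> with
\<open>j \<in> Des w\<close>. The lexicographically largest term of \<open>a\<^sub>w\<close> is \<open>w\<close>, so that the
\<open>a\<^sub>w\<close> with \<open>I' \<subseteq> Des w\<close> span \<open>F(I)\<close> (\<open>stable_subset_span_descent_sums\<close>), and
all the \<open>a\<^sub>w\<close> together form a basis. Ordered by \<open>Qind\<close>, this basis makes the matrix
upper triangular, with the diagonal entry \<open>g\<^sub>i\<close> at \<open>a\<^sub>w\<close> for \<open>i = Qind w\<close>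
(\<open>shuffle_triangular\<close>), and \<open>g\<^sub>i\<close> occurs there once for each of the \<open>\<delta>\<^sub>i\<close> permutations \<open>w\<close> with
\<open>Qind w = i\<close>.
\<close>

section \<open>Relations between cycles and adjacent transpositions\<close>

abbreviation adj :: "nat \<Rightarrow> nat \<Rightarrow> nat" where
  "adj j \<equiv> transpose j (Suc j)"

text \<open>
The inverse of the cycle \<open>l \<mapsto> l + 1 \<mapsto> \<dots> \<mapsto> m \<mapsto> l\<close>. Elements of the group algebra
are coefficient functions, so multiplying \<open>q\<close> by a permutation \<open>v\<close> on the right replaces
\<open>q w\<close> by the coefficient of \<open>q\<close> at \<open>w \<circ> v\<^sup>-\<^sup>1\<close>; the inverse is what the computations involve.
\<close>

definition cyc_inv :: "nat \<Rightarrow> nat \<Rightarrow> nat \<Rightarrow> nat" where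
  "cyc_inv l m i = (if i = l then m else if l < i \<and> i \<le> m then i - 1 else i)"

lemma cyc_inv_self [simp]: "cyc_inv l l = id"
  by (auto simp: cyc_inv_def)

lemma cyc_inv_Suc:
  assumes "l \<le> m"
  shows "cyc_inv l (Suc m) = adj m \<circ> cyc_inv l m"
  using assms by (auto simp: cyc_inv_def transpose_def fun_eq_iff)

lemma cyc_inv_adj_end:
  assumes "l \<le> m"
  shows "adj m \<circ> cyc_inv l (Suc m) = cyc_inv l m"
  using assms by (simp add: cyc_inv_Suc flip: o_assoc) (simp add: o_assoc)

text \<open>
When \<open>s\<^sub>j\<close> is multiplied onto a cycle, three cases matter: it commutes with the cycle if
\<open>j\<close> and \<open>j + 1\<close> both avoid the support, it becomes \<open>s\<^sub>j\<^sub>+\<^sub>1\<close> if it lies in the interior, and at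
\<open>m = j\<close> and \<open>m = j + 1\<close> it exchanges the two cycles that end there.
\<close>

lemma cyc_inv_adj_outside:
  assumes "l \<le> m" "Suc j < l \<or> m < j"
  shows "adj j \<circ> cyc_inv l m = cyc_inv l m \<circ> adj j"
  using assms by (auto simp: cyc_inv_def transpose_def fun_eq_iff)

lemma cyc_inv_adj_inside:
  assumes "l \<le> j" "Suc j < m"
  shows "adj j \<circ> cyc_inv l m = cyc_inv l m \<circ> adj (Suc j)"
  using assms by (auto simp: cyc_inv_def transpose_def fun_eq_iff)

lemma cyc_inv_split:
  assumes "l \<le> k" "k \<le> m"
  shows "cyc_inv l m = cyc_inv k m \<circ> cyc_inv l k"
  using assms by (auto simp: cyc_inv_def fun_eq_iff)

lemma cycle_of_list_upt:
  assumes "l \<le> m"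
  shows "cycle_of_list [l..<Suc m] i = (if i = m then l else if l \<le> i \<and> i < m then Suc i else i)"
  using assms
proof (induction "m - l" arbitrary: l i)
  case 0
  then show ?case by auto
next
  case (Suc d)
  then have "[l..<Suc m] = l # Suc l # [Suc (Suc l)..<Suc m]" 
    and "[Suc l..<Suc m] = Suc l # [Suc (Suc l)..<Suc m]" by (auto simp: upt_conv_Cons simp del: upt_Suc)
  then have "cycle_of_list [l..<Suc m] = adj l \<circ> cycle_of_list [Suc l..<Suc m]" by simp
  with Suc.hyps(1)[of "Suc l"] Suc.hyps(2) show ?case
    by (auto simp: transpose_def simp del: upt_Suc)
qed

lemma inv_cycle_of_list_upt:
  assumes "l \<le> m"
  shows "inv_into UNIV (cycle_of_list [l..<Suc m]) = cyc_inv l m"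
  by (rule inv_unique_comp)
    (use assms in \<open>auto simp: fun_eq_iff cycle_of_list_upt cyc_inv_def simp del: upt_Suc\<close>)

lemma cyc_inv_permutes:
  assumes "1 \<le> l" "l \<le> m" "m \<le> n"
  shows "cyc_inv l m \<in> Sym n"
proof -
  have "cycle_of_list [l..<Suc m] permutes set [l..<Suc m]"
    by (rule cycle_permutes)
  then have "cyc_inv l m permutes set [l..<Suc m]"
    unfolding inv_cycle_of_list_upt[OF assms(2), symmetric] by (rule permutes_inv)
  then show ?thesis
    using assms by (auto intro: permutes_subset)
qed

lemma comp_permutes_iff:
  assumes "v permutes A"
  shows "w \<circ> v permutes A \<longleftrightarrow> w permutes A"
proof
  assume "w \<circ> v permutes A"
  from permutes_compose[OF permutes_inv[OF assms] this]
  show "w permutes A"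
    by (simp add: permutes_inv_o[OF assms] flip: o_assoc)
qed (rule permutes_compose[OF assms])

lemma adj_permutes:
  assumes "j \<in> {1..n - 1}"
  shows "adj j \<in> Sym n"
  using assms by (auto intro!: permutes_swap_id)

section \<open>Subspaces of elements invariant under adjacent transpositions\<close>

text \<open>
The condition \<open>q s\<^sub>j = q\<close> for all \<open>j \<in> S\<close>, written in coefficients. The space \<open>F(I)\<close> is
\<open>stable n (nonshadow n I)\<close>.
\<close>

definition stable :: "nat \<Rightarrow> nat set \<Rightarrow> ((nat \<Rightarrow> nat) \<Rightarrow> 'a::field) set" where
  "stable n S = {q \<in> group_algebra n. \<forall>j\<in>S. \<forall>w. q (w \<circ> adj j) = q w}"

lemma stableD:
  assumes "q \<in> stable n S" "j \<in> S"
  shows "q (w \<circ> adj j) = q w"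
  using assms by (simp add: stable_def)

lemma stable_antimono: "S \<subseteq> T \<Longrightarrow> stable n T \<subseteq> stable n S"
  by (auto simp: stable_def)

lemma stable_group_algebra: "q \<in> stable n S \<Longrightarrow> q \<in> group_algebra n"
  by (simp add: stable_def)

lemma subspace_stable: "ga.subspace (stable n S)"
  by (auto simp: ga.subspace_def stable_def group_algebra_def ga_scale_def)

lemma stable_cyc_inv:
  assumes "q \<in> stable n S" "l \<le> k" "{l..<k} \<subseteq> S"
  shows "q (u \<circ> cyc_inv l k) = q u"
  using assms(2,3)
proof (induction k arbitrary: u rule: dec_induct)
  case (step k)
  then have "q (u \<circ> cyc_inv l (Suc k)) = q ((u \<circ> adj k) \<circ> cyc_inv l k)"
    by (simp add: cyc_inv_Suc o_assoc)
  also have "\<dots> = q (u \<circ> adj k)" using step.prems by (intro step.IH) auto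
  also have "\<dots> = q u" using step assms(1) by (intro stableD) auto
  finally show ?case .
qed simp

text \<open>
The product \<open>q t\<^sub>l\<close> in coefficients, see \<open>ga_mult_t_elem\<close>.
\<close>

definition t_act :: "nat \<Rightarrow> nat \<Rightarrow> ((nat \<Rightarrow> nat) \<Rightarrow> 'a::field) \<Rightarrow> (nat \<Rightarrow> nat) \<Rightarrow> 'a" where
  "t_act n l q = (\<lambda>w. \<Sum>m = l..n. q (w \<circ> cyc_inv l m))"

definition below :: "nat \<Rightarrow> nat \<Rightarrow> ((nat \<Rightarrow> nat) \<Rightarrow> 'a::field) set" where
  "below n k = ga.span (\<Union>J\<in>{J. J \<subseteq> {1..n} \<and> \<Sum>J < k}. stable n (nonshadow n J))"

text \<open>
For \<open>j \<ge> l\<close>, multiplication by \<open>s\<^sub>j\<close> exchanges the terms \<open>m = j\<close> and \<open>m = j + 1\<close>, so a sum over an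
interval \<open>M\<close> of values \<open>m\<close> is \<open>s\<^sub>j\<close>-invariant as soon as no boundary of \<open>M\<close> separates
\<open>j\<close> from \<open>j + 1\<close> and the remaining terms are fixed. A term with \<open>m > j + 1\<close> and \<open>j \<ge> l\<close> is
fixed if \<open>q\<close> is \<open>s\<^sub>j\<^sub>+\<^sub>1\<close>-invariant: below \<open>r\<close> the invariance condition is shifted
by one. This is why the elements of \<open>I\<close> up to \<open>r\<close> have to be lowered by one, while those above
\<open>r\<close>, which concern the right end of \<open>M\<close> and the terms with \<open>m < j\<close>, stay in place.
\<close>

lemma block_shuffle_in_below:
  fixes q :: "(nat \<Rightarrow> nat) \<Rightarrow> 'a::field"
  assumes I: "I \<subseteq> {1..n}" and q: "q \<in> stable n (nonshadow n I)"
    and p: "p \<in> I" and l: "1 \<le> l" "l = p \<or> Suc l = p"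
    and r: "r \<in> I" "p \<le> r"
  defines "M \<equiv> {m \<in> {r..n}. \<forall>x\<in>I. x \<le> m \<longrightarrow> x \<le> r}"
  shows "(\<lambda>w. \<Sum>m\<in>M. q (w \<circ> cyc_inv l m)) \<in> below n (\<Sum>I)"
proof -
  define f where "f x = (if p \<le> x \<and> x \<le> r then x - 1 else x)" for x :: nat
  define J where "J = f ` I - {0}"
  let ?B = "\<lambda>w. \<Sum>m\<in>M. q (w \<circ> cyc_inv l m)"
  have finI: "finite I" using I by (rule finite_subset) simp
  have M: "r \<le> m" "m \<le> n" "l \<le> m" if "m \<in> M" for m
    using that l r by (auto simp: M_def)
  have J_low: "x \<in> J" if "x \<in> I" "x < p" for x
    using that I by (force simp: J_def f_def)
  have J_mid: "x \<in> J" if "Suc x \<in> I" "p \<le> Suc x" "Suc x \<le> r" "1 \<le> x" for x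
    using that unfolding J_def f_def by (auto intro!: image_eqI[where x = "Suc x"])
  have J_high: "x \<in> J" if "x \<in> I" "r < x" for x
    using that I by (force simp: J_def f_def)
  have "J \<subseteq> {1..n}"
  proof
    fix y assume "y \<in> J"
    then obtain x where "x \<in> I" "y = f x" "y \<noteq> 0" by (auto simp: J_def)
    moreover have "f x \<le> x" by (simp add: f_def)
    moreover have "x \<le> n" using \<open>x \<in> I\<close> I by auto
    ultimately show "y \<in> {1..n}" by auto
  qed
  moreover have "\<Sum>J < \<Sum>I"
  proof -
    have "\<Sum>J \<le> \<Sum>(f ` I)"
      using finI by (intro sum_mono2) (auto simp: J_def)
    also have "\<dots> \<le> sum f I"
      using finI sum_image_le[of I id f] by simp
    also have "\<dots> < \<Sum>I"
    proof (rule sum_strict_mono_ex1[OF finI])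
      show "\<exists>x\<in>I. f x < x"
        using p r I by (intro bexI[of _ p]) (auto simp: f_def)
    qed (simp add: f_def)
    finally show ?thesis .
  qed
  moreover have "?B \<in> stable n (nonshadow n J)"
    unfolding stable_def
  proof (intro CollectI conjI ballI allI)
    show "?B \<in> group_algebra n"
      unfolding group_algebra_def
    proof (intro CollectI allI impI sum.neutral ballI)
      fix w m assume "w \<notin> Sym n" "m \<in> M"
      with M cyc_inv_permutes[of l m n] l have "w \<circ> cyc_inv l m \<notin> Sym n"
        by (simp add: comp_permutes_iff)
      then show "q (w \<circ> cyc_inv l m) = 0"
        using q by (simp add: stable_def group_algebra_def)
    qed
  next
    fix j w assume "j \<in> nonshadow n J"
    then have j: "1 \<le> j" "Suc j \<le> n" "j \<notin> J" "Suc j \<notin> J"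
      by (auto simp: nonshadow_def)
    \<comment> \<open>The left boundary \<open>r - 1\<close> of \<open>M\<close> was put into \<open>J\<close> by the shift, and the right boundary lies
      just below an element of \<open>I\<close> above \<open>r\<close>, which is also in \<open>J\<close>.\<close>
    have jM: "j \<in> M \<longleftrightarrow> Suc j \<in> M"
    proof
      assume "j \<in> M"
      then show "Suc j \<in> M"
        using j J_high[of "Suc j"] by (auto simp: M_def le_Suc_eq)
    next
      assume a: "Suc j \<in> M"
      then have "r \<noteq> Suc j" using j r J_mid[of j] by auto
      then show "j \<in> M" using a by (auto simp: M_def)
    qed
    have term_eq: "q (w \<circ> adj j \<circ> cyc_inv l m) = q (w \<circ> cyc_inv l (adj j m))" if m: "m \<in> M" for m
    proof -
      consider "m = j" | "m = Suc j" | "m < j" | "Suc j < m" "l \<le> j" | "Suc j < m" "Suc j = l"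
        | "Suc j < m" "Suc j < l" by linarith
      then show ?thesis
      proof cases
        case 1
        then show ?thesis using M[OF m] by (simp add: cyc_inv_Suc flip: o_assoc)
      next
        case 2
        then have "l \<le> j" using m jM M(3) by blast
        then show ?thesis using 2 cyc_inv_adj_end[of l j] by (simp flip: o_assoc)
      next
        case 3
        then have "j \<in> nonshadow n I"
          using j J_high[of j] J_high[of "Suc j"] M[OF m] by (auto simp: nonshadow_def)
        then show ?thesis
          using 3 cyc_inv_adj_outside[of l m j] M[OF m] stableD[OF q, of j "w \<circ> cyc_inv l m"]
          by (simp add: o_assoc[symmetric] transpose_apply_other)
      next
        case 4
        have "Suc j \<notin> I"
          using j 4 l J_mid[of j] J_high[of "Suc j"] by fastforce
        moreover have "Suc (Suc j) \<notin> I"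
        proof
          assume a: "Suc (Suc j) \<in> I"
          then have "Suc (Suc j) \<le> r" using m 4 by (auto simp: M_def)
          then show False using J_mid[of "Suc j"] a j 4 l by auto
        qed
        ultimately have "Suc j \<in> nonshadow n I"
          using M[OF m] 4 by (auto simp: nonshadow_def)
        then show ?thesis
          using 4 cyc_inv_adj_inside[of l j m] stableD[OF q, of "Suc j" "w \<circ> cyc_inv l m"]
          by (simp add: o_assoc[symmetric] transpose_apply_other)
      next
        case 5
        then show ?thesis
          using j l p r J_mid[of "l - 1"] J_mid[of l] by auto
      next
        case 6
        then have "j \<in> nonshadow n I"
          using j l J_low[of j] J_low[of "Suc j"] by (auto simp: nonshadow_def)
        then show ?thesis
          using 6 cyc_inv_adj_outside[of l m j] M[OF m] stableD[OF q, of j "w \<circ> cyc_inv l m"]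
          by (simp add: o_assoc[symmetric] transpose_apply_other)
      qed
    qed
    have "?B (w \<circ> adj j) = (\<Sum>m\<in>M. q (w \<circ> cyc_inv l (adj j m)))"
      by (intro sum.cong refl term_eq)
    also have "\<dots> = ?B w"
      by (rule sum.reindex_bij_witness[of _ "adj j" "adj j"])
        (use jM in \<open>auto simp: transpose_def\<close>)
    finally show "?B (w \<circ> adj j) = ?B w" .
  qed
  ultimately show ?thesis
    unfolding below_def by (intro ga.span_base) blast
qed

text \<open>
Since \<open>l, \<dots>, p - 2\<close> all lie in \<open>I'\<close>, the cycle on \<open>l, \<dots>, m\<close> acts on \<open>q\<close> as the identity
for \<open>m < p\<close>, and as the cycle on \<open>p - 1, \<dots>, m\<close> for \<open>m \<ge> p > l\<close>. The former
terms give the eigenvalue \<open>p - l\<close>, the latter are error terms.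
\<close>

lemma t_act_stable:
  fixes q :: "(nat \<Rightarrow> nat) \<Rightarrow> 'a::field"
  assumes I: "I \<subseteq> {1..n}" and q: "q \<in> stable n (nonshadow n I)" and l: "l \<in> {1..n}"
  shows "t_act n l q - ga_scale (of_nat (m_dist n I l)) q \<in> below n (\<Sum>I)"
proof -
  define p where "p = Min {x \<in> hat n I. x \<ge> l}"
  have finI: "finite I" using I by (rule finite_subset) simp
  have "finite {x \<in> hat n I. x \<ge> l}" using finI by (simp add: hat_def)
  moreover have "n + 1 \<in> {x \<in> hat n I. x \<ge> l}" using l by (auto simp: hat_def)
  ultimately have p: "p \<in> hat n I" "l \<le> p" and p_le: "\<And>x. x \<in> hat n I \<Longrightarrow> l \<le> x \<Longrightarrow> p \<le> x"
    unfolding p_def using Min_in Min_le by (blast, blast, force)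
  have pn: "p \<le> Suc n" using p_le[of "Suc n"] l by (auto simp: hat_def)
  have m_dist: "m_dist n I l = p - l" by (simp add: m_dist_def p_def)
  have gap: "{l..<k} \<subseteq> nonshadow n I" if "k < p" for k
    using that l pn p_le by (force simp: nonshadow_def hat_def)
  define C where "C = (\<lambda>m w. q (w \<circ> cyc_inv l m))"
  have C_low: "C m = q" if "l \<le> m" "m < p" for m
    using that gap[of m] stable_cyc_inv[OF q, of l m] by (auto simp: C_def)
  have "t_act n l q = (\<Sum>m = l..n. C m)"
    by (auto simp: t_act_def C_def sum_ga_apply)
  also have "{l..n} = {l..<p} \<union> {p..n}" using p(2) pn by auto
  also have "(\<Sum>m\<in>\<dots>. C m) = (\<Sum>m\<in>{l..<p}. C m) + (\<Sum>m = p..n. C m)"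
    by (rule sum.union_disjoint) auto
  also have "(\<Sum>m\<in>{l..<p}. C m) = ga_scale (of_nat (m_dist n I l)) q"
    using C_low by (simp add: m_dist ga_scale_def fun_eq_iff sum_ga_apply)
  finally have "t_act n l q - ga_scale (of_nat (m_dist n I l)) q = (\<Sum>m = p..n. C m)"
    by (simp only: add_diff_cancel_left')
  also have "\<dots> \<in> below n (\<Sum>I)"
  proof (cases "p = Suc n")
    case True
    then show ?thesis by (simp add: below_def ga.span_zero)
  next
    case False
    then have pI: "p \<in> I" using p l by (auto simp: hat_def)
    \<comment> \<open>The start of the cycle is moved up to \<open>p - 1\<close>, but not to \<open>p\<close>: since \<open>p \<in> I\<close>, the number
      \<open>p - 1\<close> is not in \<open>I'\<close>.\<close>
    define l' where "l' = (if l = p then p else p - 1)"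
    have l': "1 \<le> l'" "l' = p \<or> Suc l' = p" using p(2) l by (auto simp: l'_def)
    have C_high: "C m = (\<lambda>w. q (w \<circ> cyc_inv l' m))" if "p \<le> m" for m
    proof
      fix w
      have le: "l \<le> l'" "l' \<le> m" using p that by (auto simp: l'_def)
      have "{l..<l'} \<subseteq> nonshadow n I" using gap[of "p - 1"] p(2) l by (auto simp: l'_def)
      from stable_cyc_inv[OF q le(1) this]
      show "C m w = q (w \<circ> cyc_inv l' m)"
        by (simp add: C_def cyc_inv_split[OF le] o_assoc)
    qed
    define prev where "prev m = Max {x \<in> I. x \<le> m}" for m
    have prev: "prev m = r \<longleftrightarrow> r \<in> I \<and> r \<le> m \<and> (\<forall>x\<in>I. x \<le> m \<longrightarrow> x \<le> r)" if "p \<le> m" for m r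
      unfolding prev_def using that pI finI by (subst Max_eq_iff) auto
    have "(\<Sum>m = p..n. C m) = (\<Sum>r\<in>I \<inter> {p..n}. \<Sum>m\<in>{m \<in> {p..n}. prev m = r}. C m)"
    proof (rule sum.group[symmetric])
      show "prev ` {p..n} \<subseteq> I \<inter> {p..n}"
      proof
        fix r assume "r \<in> prev ` {p..n}"
        then obtain m where m: "m \<in> {p..n}" "prev m = r" by auto
        then have "r \<in> I" "r \<le> m" "p \<le> r" using prev[of m r] pI by auto
        then show "r \<in> I \<inter> {p..n}" using m by auto
      qed
    qed (use finI in auto)
    also have "\<dots> \<in> below n (\<Sum>I)"
      unfolding below_def
    proof (rule ga.span_sum)
      fix r assume r: "r \<in> I \<inter> {p..n}"
      then have "{m \<in> {p..n}. prev m = r} = {m \<in> {r..n}. \<forall>x\<in>I. x \<le> m \<longrightarrow> x \<le> r}"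
        using prev by auto
      moreover have "(\<Sum>m\<in>{m \<in> {p..n}. prev m = r}. C m)
          = (\<lambda>w. \<Sum>m\<in>{m \<in> {p..n}. prev m = r}. q (w \<circ> cyc_inv l' m))"
        using C_high by (auto simp: fun_eq_iff sum_ga_apply)
      ultimately show "(\<Sum>m\<in>{m \<in> {p..n}. prev m = r}. C m)
          \<in> ga.span (\<Union>J\<in>{J. J \<subseteq> {1..n} \<and> \<Sum>J < \<Sum>I}. stable n (nonshadow n J))"
        using block_shuffle_in_below[OF I q pI l', of r] r by (simp add: below_def)
    qed
    finally show ?thesis .
  qed
  finally show ?thesis .
qed

section \<open>Lacunar sets suffice\<close>

text \<open>
If \<open>a, a + 1 \<in> J\<close> or \<open>a = n \<in> J\<close>, replace \<open>a\<close> by \<open>a - 1\<close> (or drop it if \<open>a = 1\<close>). An element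
\<open>a\<close> removes \<open>a - 1\<close> and \<open>a\<close> from \<open>J'\<close>; after the move, \<open>a - 1\<close> is still removed by the new element
(or is \<open>0\<close>), and \<open>a\<close> is removed by \<open>a + 1\<close> or lies outside \<open>[n - 1]\<close>. So \<open>J'\<close> can only shrink, the sum
decreases, and the process ends with a lacunar subset of \<open>[n - 1]\<close>.
\<close>

lemma lacunar_refinement:
  assumes "J \<subseteq> {1..n}"
  shows "\<exists>K \<subseteq> {1..n - 1}. lacunar K \<and> nonshadow n K \<subseteq> nonshadow n J \<and> \<Sum>K \<le> \<Sum>J"
  using assms
proof (induction "\<Sum>J" arbitrary: J rule: less_induct)
  case less
  have fin: "finite J" using less.prems by (rule finite_subset) simp
  show ?case
  proof (cases "\<exists>a\<in>J. Suc a \<in> J \<or> a = n")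
    case True
    then obtain a where a: "a \<in> J" "Suc a \<in> J \<or> a = n" by blast
    then have a1: "1 \<le> a" using less.prems by auto
    define K where "K = (J - {a}) \<union> ({a - 1} - {0})"
    have sub: "K \<subseteq> {1..n}"
      using less.prems a by (force simp: K_def)
    have "\<Sum>K \<le> \<Sum>(J - {a}) + \<Sum>({a - 1} - {0})"
      using fin sum.union_inter[of "J - {a}" "{a - 1} - {0}" "\<lambda>x. x"] by (simp add: K_def)
    also have "\<dots> < \<Sum>(J - {a}) + a"
      using a1 by (cases "a = 1") auto
    also have "\<dots> = \<Sum>J"
      using sum.remove[OF fin a(1), of "\<lambda>x. x"] by simp
    finally have less': "\<Sum>K < \<Sum>J" .
    have shadow: "nonshadow n K \<subseteq> nonshadow n J"
    proof
      fix i assume "i \<in> nonshadow n K"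
      then have i: "1 \<le> i" "Suc i \<le> n" "i \<notin> K" "Suc i \<notin> K"
        by (auto simp: nonshadow_def)
      have "i \<notin> J" using i a by (auto simp: K_def)
      moreover have "Suc i \<notin> J" using i by (auto simp: K_def)
      ultimately show "i \<in> nonshadow n J" using i by (auto simp: nonshadow_def)
    qed
    from less.hyps[OF less' sub] shadow less' show ?thesis
      by (meson less_imp_le order_trans)
  next
    case False
    then have "J \<subseteq> {1..n - 1}"
      using less.prems by (force simp: subset_iff)
    moreover have "lacunar J" using False by (auto simp: lacunar_def)
    ultimately show ?thesis by blast
  qed
qed

lemma lacunar_listing_range:
  assumes "lacunar_listing n Q" "i \<in> {1..fib (n + 1)}"
  shows "Q i \<subseteq> {1..n - 1}"
  using assms by (auto simp: lacunar_listing_def bij_betw_def)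

lemma lacunar_listing_obtain:
  assumes "lacunar_listing n Q" "K \<subseteq> {1..n - 1}" "lacunar K"
  obtains k where "k \<in> {1..fib (n + 1)}" "K = Q k"
proof -
  have "K \<in> Q ` {1..fib (n + 1)}"
    using assms by (auto simp: lacunar_listing_def bij_betw_def)
  then show ?thesis using that by blast
qed

text \<open>
This is the only place where the order of the listing matters: a set of smaller sum than
\<open>Q\<^sub>i\<close> must precede \<open>Q\<^sub>i\<close>.
\<close>

lemma below_subset_earlier:
  assumes Q: "lacunar_listing n Q" and i: "i \<in> {1..fib (n + 1)}"
  shows "below n (\<Sum>(Q i)) \<subseteq> ga.span (\<Union>k\<in>{k \<in> {1..fib (n + 1)}. k < i}. stable n (nonshadow n (Q k)))"
    (is "_ \<subseteq> ga.span ?U")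
  unfolding below_def
proof (rule ga.span_minimal)
  show "(\<Union>J\<in>{J. J \<subseteq> {1..n} \<and> \<Sum>J < \<Sum>(Q i)}. stable n (nonshadow n J)) \<subseteq> ga.span ?U"
  proof (rule UN_least)
    fix J assume J: "J \<in> {J. J \<subseteq> {1..n} \<and> \<Sum>J < \<Sum>(Q i)}"
    with lacunar_refinement[of J n] obtain K where K: "K \<subseteq> {1..n - 1}" "lacunar K"
      "nonshadow n K \<subseteq> nonshadow n J" "\<Sum>K \<le> \<Sum>J" by blast
    from lacunar_listing_obtain[OF Q K(1,2)] obtain k where k: "k \<in> {1..fib (n + 1)}" "K = Q k" .
    have "k < i"
    proof (rule ccontr)
      assume "\<not> k < i"
      then have "\<Sum>(Q i) \<le> \<Sum>(Q k)"
        using Q i k by (auto simp: lacunar_listing_def mono_on_def)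
      then show False using K k J by auto
    qed
    then have "stable n (nonshadow n J) \<subseteq> ?U"
      using stable_antimono[OF K(3)] k by blast
    then show "stable n (nonshadow n J) \<subseteq> ga.span ?U"
      using ga.span_superset by blast
  qed
qed (rule ga.subspace_span)

lemma Qind_props:
  assumes Q: "lacunar_listing n Q"
  shows "Qind n Q w \<in> {1..fib (n + 1)}" "nonshadow n (Q (Qind n Q w)) \<subseteq> Des n w"
proof -
  \<comment> \<open>Some listed set has empty nonshadow, because \<open>{1..n}\<close> does.\<close>
  obtain K where K: "K \<subseteq> {1..n - 1}" "lacunar K" "nonshadow n K \<subseteq> nonshadow n {1..n}"
    using lacunar_refinement[of "{1..n}" n] by blast
  then have "nonshadow n K = {}" by (auto simp: nonshadow_def)
  moreover obtain k where "k \<in> {1..fib (n + 1)}" "K = Q k"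
    using lacunar_listing_obtain[OF Q K(1,2)] .
  ultimately have "k \<in> {1..fib (n + 1)} \<and> nonshadow n (Q k) \<subseteq> Des n w" by simp
  from LeastI[of "\<lambda>i. i \<in> {1..fib (n + 1)} \<and> nonshadow n (Q i) \<subseteq> Des n w", OF this]
  show "Qind n Q w \<in> {1..fib (n + 1)}" "nonshadow n (Q (Qind n Q w)) \<subseteq> Des n w"
    unfolding Qind_def by simp_all
qed

lemma Qind_le:
  assumes "k \<in> {1..fib (n + 1)}" "nonshadow n (Q k) \<subseteq> Des n w"
  shows "Qind n Q w \<le> k"
  unfolding Qind_def using assms by (intro Least_le) simp

section \<open>The descent-destroying basis\<close>

inductive_set coset :: "nat set \<Rightarrow> (nat \<Rightarrow> nat) \<Rightarrow> (nat \<Rightarrow> nat) set" for S w where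
  self: "w \<in> coset S w"
| step: "u \<in> coset S w \<Longrightarrow> j \<in> S \<Longrightarrow> u \<circ> adj j \<in> coset S w"

text \<open>
The sum \<open>a\<^sub>w\<close> of the coset \<open>w W\<close>.
\<close>

definition descent_sum :: "nat \<Rightarrow> (nat \<Rightarrow> nat) \<Rightarrow> (nat \<Rightarrow> nat) \<Rightarrow> 'a::field" where
  "descent_sum n w = (\<lambda>u. if u \<in> coset (Des n w) w then 1 else 0)"

lemma Des_subset: "Des n w \<subseteq> {1..n - 1}"
  by (auto simp: Des_def)

lemma coset_adj_iff:
  assumes "j \<in> S"
  shows "u \<circ> adj j \<in> coset S w \<longleftrightarrow> u \<in> coset S w"
proof
  assume "u \<circ> adj j \<in> coset S w"
  from coset.step[OF this assms] show "u \<in> coset S w"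
    by (simp add: o_assoc[symmetric])
qed (rule coset.step[OF _ assms])

lemma coset_permutes:
  assumes "u \<in> coset S w" "w \<in> Sym n" "S \<subseteq> {1..n - 1}"
  shows "u \<in> Sym n"
  using assms(1)
proof induction
  case (step u j)
  then have "adj j \<in> Sym n" using assms(3) adj_permutes by blast
  then show ?case using step.IH permutes_compose by blast
qed (rule assms(2))

lemma descent_sum_stable:
  assumes "w \<in> Sym n"
  shows "descent_sum n w \<in> stable n (Des n w)"
  using assms coset_permutes[OF _ assms Des_subset]
  by (auto simp: stable_def group_algebra_def descent_sum_def coset_adj_iff)

text \<open>
Elements of the coset permute the values of \<open>w\<close> only within maximal runs of \<open>S\<close>: the value of
\<open>u\<close> at \<open>i\<close> comes from a position \<open>k\<close> all of whose intermediate steps to \<open>i\<close> belong to \<open>S\<close>.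
\<close>

lemma coset_block:
  assumes "u \<in> coset S w"
  shows "\<exists>k. u i = w k \<and> {min i k..<max i k} \<subseteq> S"
  using assms
proof (induction arbitrary: i)
  case self
  then show ?case by (intro exI[of _ i]) simp
next
  case (step u j)
  obtain k where k: "u (adj j i) = w k" "{min (adj j i) k..<max (adj j i) k} \<subseteq> S"
    using step.IH by blast
  have "x \<in> S" if "x \<in> {min i k..<max i k}" for x
  proof (cases "x = j")
    case True
    then show ?thesis using step.hyps by simp
  next
    case False
    then have "x \<in> {min (adj j i) k..<max (adj j i) k}"
      using that by (auto simp: transpose_def)
    then show ?thesis using k by blast
  qed
  then show ?case using k(1) by (intro exI[of _ k]) auto
qed

lemma Des_decreasing:
  assumes "i < k" "{i..<k} \<subseteq> Des n w"
  shows "w k < w i"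
  using assms
proof (induction k rule: less_induct)
  case (less k)
  then obtain k' where k': "k = Suc k'" "i \<le> k'" by (cases k) auto
  then have "k' \<in> Des n w" using less.prems by auto
  then have "w k < w k'" using k' by (simp add: Des_def)
  moreover have "w k' \<le> w i"
  proof (cases "i = k'")
    case False
    moreover have "{i..<k'} \<subseteq> Des n w" using less.prems(2) k' by auto
    ultimately show ?thesis using less.IH[of k'] k' by simp
  qed simp
  ultimately show ?case by simp
qed

text \<open>
At the first position \<open>i\<close> where \<open>u\<close> and \<open>w\<close> differ, the value \<open>u i\<close> is a later value of \<open>w\<close> from the
same decreasing run, hence smaller than \<open>w i\<close>.
\<close>

lemma coset_Des_less_fun:
  assumes w: "w \<in> Sym n" and u: "u \<in> coset (Des n w) w" and "u \<noteq> w"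
  shows "less_fun u w"
proof -
  define i where "i = (LEAST i. u i \<noteq> w i)"
  have "\<exists>i. u i \<noteq> w i" using \<open>u \<noteq> w\<close> by auto
  then have i: "u i \<noteq> w i" unfolding i_def by (rule LeastI_ex)
  have agree: "u k = w k" if "k < i" for k
    using that not_less_Least unfolding i_def by blast
  from coset_block[OF u] obtain k where k: "u i = w k" "{min i k..<max i k} \<subseteq> Des n w" by blast
  have "u \<in> Sym n" using coset_permutes[OF u w Des_subset] .
  then have "inj u" by (auto dest: permutes_inj)
  have "\<not> k < i"
  proof
    assume "k < i"
    then have "u i = u k" using k agree by simp
    then show False using \<open>inj u\<close> \<open>k < i\<close> by (simp add: inj_eq)
  qed
  moreover have "k \<noteq> i" using k i by auto
  ultimately have "i < k" by simp
  then have "u i < w i" using k Des_decreasing[of i k n w] by simp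
  then show ?thesis using agree by (auto simp: less_fun_def)
qed

lemma ascent_less_fun:
  assumes "w \<in> Sym n" "j \<in> {1..n - 1}" "j \<notin> Des n w"
  shows "less_fun w (w \<circ> adj j)"
proof -
  have "inj w" using assms by (auto dest: permutes_inj)
  then have "w j \<noteq> w (Suc j)" by (simp add: inj_eq)
  then have "w j < w (Suc j)" using assms by (auto simp: Des_def)
  then show ?thesis unfolding less_fun_def
    by (intro exI[of _ j]) auto
qed

text \<open>
Leading term elimination. If \<open>w\<close> is the lexicographically largest permutation in the support
of \<open>q\<close> and \<open>j \<in> S\<close>, then \<open>w \<circ> s\<^sub>j\<close> is in the support too, so that \<open>j\<close> must be a descent of
\<open>w\<close>. Subtracting a multiple of \<open>a\<^sub>w\<close> then removes \<open>w\<close> and introduces only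
smaller permutations.
\<close>

lemma stable_subset_span_descent_sums:
  fixes q :: "(nat \<Rightarrow> nat) \<Rightarrow> 'a::field"
  assumes S: "S \<subseteq> {1..n - 1}" and q: "q \<in> stable n S"
  shows "q \<in> ga.span (descent_sum n ` {v \<in> Sym n. S \<subseteq> Des n v})" (is "_ \<in> ga.span ?B")
proof -
  \<comment> \<open>Induction over downward closed sets \<open>D\<close> that contain the support: taking away the largest
    element leaves a downward closed set, whereas the support itself may grow.\<close>
  have "q \<in> ga.span ?B"
    if "finite D" "D \<subseteq> Sym n" "\<And>u v. u \<in> D \<Longrightarrow> v \<in> Sym n \<Longrightarrow> less_fun v u \<Longrightarrow> v \<in> D"
      "q \<in> stable n S" "{w. q w \<noteq> 0} \<subseteq> D" for D and q :: "(nat \<Rightarrow> nat) \<Rightarrow> 'a"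
    using that
  proof (induction D arbitrary: q rule: finite_psubset_induct)
    case (psubset D)
    show ?case
    proof (cases "D = {}")
      case True
      then have "q = 0" using psubset.prems by auto
      then show ?thesis by (simp only: ga.span_zero)
    next
      case False
      have "asymp_on D less_fun" "transp_on D less_fun"
        by (auto intro!: asymp_onI transp_onI dest: less_fun_asym intro: less_fun_trans)
      from Finite_Set.bex_max_element[OF psubset.hyps this False]
      obtain w where w: "w \<in> D" and w_max: "\<And>x. x \<in> D \<Longrightarrow> x \<noteq> w \<Longrightarrow> \<not> less_fun w x" by blast
      have wS: "w \<in> Sym n" using w psubset.prems by blast
      define q' where "q' = q - ga_scale (q w) (descent_sum n w)"
      have "q' \<in> stable n S \<and> ga_scale (q w) (descent_sum n w) \<in> ga.span ?B"
      proof (cases "q w = 0")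
        case True
        then have "ga_scale (q w) (descent_sum n w) = 0" by (simp only: ga.scale_zero_left)
        then show ?thesis
          using psubset.prems(3) by (simp only: q'_def diff_zero ga.span_zero simp_thms)
      next
        case False
        have "S \<subseteq> Des n w"
        proof (rule ccontr)
          assume "\<not> S \<subseteq> Des n w"
          then obtain j where j: "j \<in> S" "j \<notin> Des n w" by blast
          then have "less_fun w (w \<circ> adj j)" using ascent_less_fun[OF wS] S by blast
          moreover have "q (w \<circ> adj j) = q w" using stableD[OF psubset.prems(3) j(1)] .
          then have "w \<circ> adj j \<in> D" using psubset.prems(4) False by auto
          ultimately show False using w_max less_fun_irrefl by metis
        qed
        then have "descent_sum n w \<in> stable n S" "descent_sum n w \<in> (?B :: (_ \<Rightarrow> 'a) set)"
          using wS descent_sum_stable[OF wS] stable_antimono by blast+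
        then show ?thesis
          unfolding q'_def using psubset.prems(3)
          by (intro conjI ga.subspace_diff[OF subspace_stable] ga.subspace_scale[OF subspace_stable]
              ga.span_scale ga.span_base)
      qed
      moreover have "q' \<in> ga.span ?B"
      proof (rule psubset.IH[of "D - {w}"])
        show "v \<in> D - {w}" if "u \<in> D - {w}" "v \<in> Sym n" "less_fun v u" for u v
          using that psubset.prems(2)[of u v] w_max[of u] by blast
        show "{u. q' u \<noteq> 0} \<subseteq> D - {w}"
        proof
          fix u assume u: "u \<in> {u. q' u \<noteq> 0}"
          have "u \<noteq> w" using u by (auto simp: q'_def ga_scale_def descent_sum_def coset.self)
          moreover have "u \<in> D"
          proof (cases "u \<in> coset (Des n w) w")
            case True
            then show ?thesis
              using coset_Des_less_fun[OF wS True \<open>u \<noteq> w\<close>] coset_permutes[OF True wS Des_subset]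
                psubset.prems(2)[OF w] by blast
          next
            case False
            then show ?thesis
              using u psubset.prems(4) by (auto simp: q'_def ga_scale_def descent_sum_def)
          qed
          ultimately show "u \<in> D - {w}" by blast
        qed
      qed (use w psubset.prems(1) calculation in auto)
      ultimately have "q' + ga_scale (q w) (descent_sum n w) \<in> ga.span ?B"
        by (intro ga.span_add) auto
      then show ?thesis by (simp only: q'_def diff_add_cancel)
    qed
  qed
  from this[of "Sym n" q] q show ?thesis
    by (auto simp: finite_permutations stable_def group_algebra_def)
qed

text \<open>
A spanning list of the right length has no repetitions and is linearly independent. Hence
the map \<open>w \<mapsto> a\<^sub>w\<close> need not be shown to be injective separately.
\<close>

lemma (in endo_space) ordered_basis_of_spanning:
  assumes cs: "ordered_basis V cs"
    and bs: "set bs \<subseteq> V" "V \<subseteq> span (set bs)" "length bs = length cs"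
  shows "ordered_basis V bs"
proof -
  obtain A where A: "A \<subseteq> set bs" "independent A" "set bs \<subseteq> span A"
    using maximal_independent_subset[of "set bs"] by blast
  have V: "subspace V" using cs by (auto simp: ordered_basis_def)
  have "dim V = length cs"
    using cs dim_eq_card[of "set cs" V] by (auto simp: ordered_basis_def distinct_card span_span)
  moreover have "V \<subseteq> span A"
    using bs(2) span_minimal[OF A(3) subspace_span] by blast
  then have "dim V \<le> card A"
    using A(1) by (intro dim_le_card) (auto intro: finite_subset)
  moreover have "card A \<le> card (set bs)" using A(1) by (intro card_mono) auto
  moreover have "card (set bs) \<le> length bs" by (rule card_length)
  ultimately have "card A = card (set bs)" "card (set bs) = length bs" using bs(3) by linarith+
  then have "A = set bs" "distinct bs"
    using A(1) card_subset_eq[of "set bs" A] card_distinct by auto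
  moreover have "span (set bs) = V"
    using bs V span_minimal by blast
  ultimately show ?thesis using A by (simp add: ordered_basis_def)
qed

lemma descent_sum_basis:
  assumes "distinct ws" "set ws = Sym n"
  shows "ga.ordered_basis (group_algebra n) (map (descent_sum n :: _ \<Rightarrow> _ \<Rightarrow> 'a::field) ws)"
proof (rule ga.ordered_basis_of_spanning[OF ga_standard_basis[OF assms]])
  show "set (map (descent_sum n) ws) \<subseteq> (group_algebra n :: (_ \<Rightarrow> 'a) set)"
    using assms descent_sum_stable by (auto simp: stable_def)
  show "group_algebra n \<subseteq> ga.span (set (map (descent_sum n :: _ \<Rightarrow> _ \<Rightarrow> 'a) ws))"
    using stable_subset_span_descent_sums[of "{}" n] assms by (auto simp: stable_def)
qed simp

section \<open>Triangular endomorphisms\<close>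

lemma (in endo_space) endo_char_poly_triangular:
  assumes bs: "ordered_basis V bs"
    and F: "\<And>x. x \<in> V \<Longrightarrow> F x \<in> V"
    and add: "\<And>x y. x \<in> V \<Longrightarrow> y \<in> V \<Longrightarrow> F (x + y) = F x + F y"
    and sc: "\<And>a x. x \<in> V \<Longrightarrow> F (a *s x) = a *s F x"
    and tri: "\<And>j. j < length bs \<Longrightarrow> F (bs ! j) - d j *s bs ! j \<in> span (set (take j bs))"
  shows "endo_char_poly V F = (\<Prod>j\<leftarrow>[0..<length bs]. [:- d j, 1:])"
proof -
  have ind: "independent (set bs)" and dist: "distinct bs"
    using bs by (auto simp: ordered_basis_def)
  have entry: "representation (set bs) (F (bs ! j)) (bs ! i) = (if i = j then d j else 0)"
    if "j \<le> i" "i < length bs" for i j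
  proof -
    define x where "x = F (bs ! j) - d j *s bs ! j"
    have x: "x \<in> span (set (take j bs))" using tri that by (simp add: x_def)
    have bj: "bs ! j \<in> set bs" using that by simp
    have notin: "bs ! i \<notin> set (take j bs)"
      using that dist by (auto simp: in_set_conv_nth nth_eq_iff_index_eq)
    have "representation (set bs) x (bs ! i) = 0"
      using representation_extend[OF ind x set_take_subset] notin representation_ne_zero by metis
    moreover have "F (bs ! j) = x + d j *s bs ! j" by (simp add: x_def)
    moreover have "x \<in> span (set bs)" using x span_mono[OF set_take_subset] by blast
    ultimately show ?thesis
      using bj that dist
      by (simp add: representation_add[OF ind] representation_scale[OF ind]
          representation_basis[OF ind] span_base span_scale nth_eq_iff_index_eq)
  qed
  let ?M = "matrix_wrt bs F"
  have M: "?M \<in> carrier_mat (length bs) (length bs)" by (simp add: matrix_wrt_def)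
  have "upper_triangular ?M"
    by (auto simp: upper_triangular_def matrix_wrt_def entry)
  then have "char_poly ?M = (\<Prod>a\<leftarrow>diag_mat ?M. [:- a, 1:])"
    by (rule char_poly_upper_triangular[OF M])
  moreover have "diag_mat ?M = map d [0..<length bs]"
    by (auto simp: diag_mat_def matrix_wrt_def entry)
  ultimately show ?thesis
    using endo_char_poly_eq[OF bs F add sc] by (simp add: comp_def)
qed

lemma order_prod_list_linear:
  "Polynomial.order \<kappa> (\<Prod>x\<leftarrow>xs. [:- f x, 1:]) = length (filter (\<lambda>x. f x = (\<kappa> :: 'a::field)) xs)"
proof (induction xs)
  case (Cons x xs)
  have "(\<Prod>x\<leftarrow>xs. [:- f x, 1:]) \<noteq> 0" by (auto simp: prod_list_zero_iff)
  then have "[:- f x, 1:] * (\<Prod>x\<leftarrow>xs. [:- f x, 1:]) \<noteq> 0"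
    by (simp only: mult_eq_0_iff) simp
  then have "Polynomial.order \<kappa> (\<Prod>x\<leftarrow>x # xs. [:- f x, 1:])
      = Polynomial.order \<kappa> [:- f x, 1:] + Polynomial.order \<kappa> (\<Prod>x\<leftarrow>xs. [:- f x, 1:])"
    unfolding list.map prod_list.Cons by (rule Polynomial.order_mult)
  moreover have "Polynomial.order \<kappa> [:- f x, 1:] = (if f x = \<kappa> then 1 else 0)"
    using order_linear_power'[of \<kappa> "f x" 1] by (auto simp: order_root intro: order_0I)
  ultimately show ?case using Cons.IH by simp
qed simp

section \<open>Right multiplication by one-sided cycle shuffles\<close>

lemma ga_mult_perm:
  fixes y :: "(nat \<Rightarrow> nat) \<Rightarrow> 'a::field"
  assumes y: "y \<in> group_algebra n" and v: "v \<in> Sym n" and v': "v \<circ> v' = id" "v' \<circ> v = id"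
  shows "ga_mult n y (ga_perm v) = (\<lambda>w. y (w \<circ> v'))"
proof
  fix w
  define A where "A = {(u, v). u \<in> Sym n \<and> v \<in> Sym n \<and> u \<circ> v = w}"
  have "finite A"
    by (rule finite_subset[of _ "Sym n \<times> Sym n"]) (auto simp: A_def finite_permutations)
  have u: "u = w \<circ> v'" if "u \<circ> v = w" for u
    using that v' by (auto simp: o_assoc[symmetric])
  have "ga_mult n y (ga_perm v) w = (\<Sum>z\<in>A. if z = (w \<circ> v', v) then y (w \<circ> v') else 0)"
    unfolding ga_mult_def A_def[symmetric]
  proof (intro sum.cong refl)
    fix z assume "z \<in> A"
    then obtain a b where z: "z = (a, b)" "a \<circ> b = w" by (auto simp: A_def)
    show "(case z of (u, v') \<Rightarrow> y u * ga_perm v v') = (if z = (w \<circ> v', v) then y (w \<circ> v') else 0)"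
    proof (cases "b = v")
      case True
      then have "a = w \<circ> v'" using u z(2) by blast
      then show ?thesis using True z(1) by (simp add: ga_perm_def)
    qed (simp add: z(1) ga_perm_def)
  qed
  also have "\<dots> = (if (w \<circ> v', v) \<in> A then y (w \<circ> v') else 0)"
    using \<open>finite A\<close> by simp
  also have "\<dots> = y (w \<circ> v')"
    using y v v' by (auto simp: A_def group_algebra_def o_assoc[symmetric])
  finally show "ga_mult n y (ga_perm v) w = y (w \<circ> v')" .
qed

lemma ga_mult_sum_right:
  "ga_mult n y (\<Sum>i\<in>A. ga_scale (c i) (x i)) = (\<Sum>i\<in>A. ga_scale (c i) (ga_mult n y (x i)))"
proof
  fix w
  let ?P = "{(u, v). u \<in> Sym n \<and> v \<in> Sym n \<and> u \<circ> v = w}"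
  have "ga_mult n y (\<Sum>i\<in>A. ga_scale (c i) (x i)) w
      = (\<Sum>z\<in>?P. \<Sum>i\<in>A. c i * (y (fst z) * x i (snd z)))"
    by (simp add: ga_mult_def sum_ga_apply ga_scale_def sum_distrib_left case_prod_unfold algebra_simps)
  also have "\<dots> = (\<Sum>i\<in>A. \<Sum>z\<in>?P. c i * (y (fst z) * x i (snd z)))"
    by (rule sum.swap)
  also have "\<dots> = (\<Sum>i\<in>A. ga_scale (c i) (ga_mult n y (x i))) w"
    by (simp add: ga_mult_def sum_ga_apply ga_scale_def sum_distrib_left case_prod_unfold)
  finally show "ga_mult n y (\<Sum>i\<in>A. ga_scale (c i) (x i)) w
      = (\<Sum>i\<in>A. ga_scale (c i) (ga_mult n y (x i))) w" .
qed

lemma ga_mult_t_elem: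
  assumes y: "y \<in> group_algebra n" and l: "1 \<le> l"
  shows "ga_mult n y (t_elem n l) = t_act n l y"
proof -
  have cyc: "ga_mult n y (ga_perm (cycle_of_list [l..<Suc m])) = (\<lambda>w. y (w \<circ> cyc_inv l m))"
    if "m \<in> {l..n}" for m
  proof (rule ga_mult_perm[OF y])
    have "cycle_of_list [l..<Suc m] permutes set [l..<Suc m]"
      by (rule cycle_permutes)
    then show "cycle_of_list [l..<Suc m] \<in> Sym n"
      using that l by (auto simp del: upt_Suc intro: permutes_subset)
  qed (use that in \<open>auto simp: fun_eq_iff cycle_of_list_upt cyc_inv_def simp del: upt_Suc\<close>)
  have "ga_mult n y (t_elem n l)
      = (\<Sum>m = l..n. ga_mult n y (ga_perm (cycle_of_list [l..<Suc m])))"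
    using ga_mult_sum_right[of n y "\<lambda>m. 1" "\<lambda>m. ga_perm (cycle_of_list [l..<Suc m])" "{l..n}"]
    by (simp add: t_elem_def del: upt_Suc)
  also have "\<dots> = (\<Sum>m = l..n. (\<lambda>w. y (w \<circ> cyc_inv l m)))"
    by (intro sum.cong refl cyc)
  also have "\<dots> = t_act n l y"
    by (auto simp: t_act_def sum_ga_apply)
  finally show ?thesis .
qed

lemma right_mult_shuffle:
  assumes "y \<in> group_algebra n"
  shows "right_mult n (\<Sum>l = 1..n. ga_scale (lam l) (t_elem n l)) y
    = (\<Sum>l = 1..n. ga_scale (lam l) (t_act n l y))"
  unfolding right_mult_def ga_mult_sum_right
  by (intro sum.cong refl) (simp add: ga_mult_t_elem[OF assms])

lemma t_act_group_algebra:
  assumes "q \<in> group_algebra n" "1 \<le> l"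
  shows "t_act n l q \<in> group_algebra n"
  unfolding group_algebra_def t_act_def
proof (intro CollectI allI impI sum.neutral ballI)
  fix w m assume "w \<notin> Sym n" "m \<in> {l..n}"
  with cyc_inv_permutes[of l m n] assms(2) have "w \<circ> cyc_inv l m \<notin> Sym n"
    by (simp add: comp_permutes_iff)
  then show "q (w \<circ> cyc_inv l m) = 0"
    using assms(1) by (simp add: group_algebra_def)
qed

text \<open>
The element \<open>a\<^sub>w\<close> lies in \<open>F(Q\<^sub>i)\<close> for \<open>i = Qind w\<close>, so its error term lies in the sum of
the \<open>F(Q\<^sub>k)\<close> with \<open>k < i\<close>; these are spanned by elements \<open>a\<^sub>v\<close> with \<open>Q\<^sub>k' \<subseteq> Des v\<close>, that is, with
\<open>Qind v \<le> k\<close>.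
\<close>

lemma shuffle_triangular:
  fixes lam :: "nat \<Rightarrow> 'a::field"
  assumes Q: "lacunar_listing n Q" and w: "w \<in> Sym n"
  defines "a \<equiv> descent_sum n :: _ \<Rightarrow> _ \<Rightarrow> 'a"
  shows "right_mult n (\<Sum>l = 1..n. ga_scale (lam l) (t_elem n l)) (a w)
      - ga_scale (g_val n lam Q (Qind n Q w)) (a w)
    \<in> ga.span (a ` {v \<in> Sym n. Qind n Q v < Qind n Q w})"
proof -
  define i where "i = Qind n Q w"
  have i: "i \<in> {1..fib (n + 1)}" "nonshadow n (Q i) \<subseteq> Des n w"
    unfolding i_def by (rule Qind_props[OF Q])+
  have Qi: "Q i \<subseteq> {1..n}" using lacunar_listing_range[OF Q i(1)] by (rule order_trans) auto
  have aw: "a w \<in> stable n (nonshadow n (Q i))"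
    using descent_sum_stable[OF w] stable_antimono[OF i(2)] unfolding a_def by blast
  have scale_sum: "ga_scale (\<Sum>l\<in>L. c l * d l) x = (\<Sum>l\<in>L. ga_scale (c l) (ga_scale (d l) x))"
    for c d :: "nat \<Rightarrow> 'a" and L x
    by (simp add: ga_scale_def fun_eq_iff sum_ga_apply sum_distrib_right mult.assoc)
  have "right_mult n (\<Sum>l = 1..n. ga_scale (lam l) (t_elem n l)) (a w) - ga_scale (g_val n lam Q i) (a w)
      = (\<Sum>l = 1..n. ga_scale (lam l) (t_act n l (a w) - ga_scale (of_nat (m_dist n (Q i) l)) (a w)))"
    unfolding right_mult_shuffle[OF stable_group_algebra[OF aw]] g_val_def scale_sum
    by (simp only: ga.scale_right_diff_distrib sum_subtractf)
  also have "\<dots> \<in> below n (\<Sum>(Q i))"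
    unfolding below_def
    by (intro ga.span_sum ga.span_scale) (rule t_act_stable[OF Qi aw, unfolded below_def])
  also have "\<dots> \<subseteq> ga.span (\<Union>k\<in>{k \<in> {1..fib (n + 1)}. k < i}. stable n (nonshadow n (Q k)))"
    by (rule below_subset_earlier[OF Q i(1)])
  also have "\<dots> \<subseteq> ga.span (a ` {v \<in> Sym n. Qind n Q v < i})"
  proof (intro ga.span_minimal UN_least subsetI)
    fix k and q :: "(nat \<Rightarrow> nat) \<Rightarrow> 'a"
    assume k: "k \<in> {k \<in> {1..fib (n + 1)}. k < i}" and q: "q \<in> stable n (nonshadow n (Q k))"
    have "q \<in> ga.span (a ` {v \<in> Sym n. nonshadow n (Q k) \<subseteq> Des n v})"
      unfolding a_def by (rule stable_subset_span_descent_sums[OF _ q]) (auto simp: nonshadow_def)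
    moreover have "a ` {v \<in> Sym n. nonshadow n (Q k) \<subseteq> Des n v} \<subseteq> a ` {v \<in> Sym n. Qind n Q v < i}"
      using k Qind_le[of k n Q] by fastforce
    ultimately show "q \<in> ga.span (a ` {v \<in> Sym n. Qind n Q v < i})"
      using ga.span_mono by blast
  qed (rule ga.subspace_span)
  finally show ?thesis unfolding i_def .
qed

theorem theorem13p2:
  fixes n :: nat and lam :: "nat \<Rightarrow> 'a::field" and \<kappa> :: 'a and Q :: "nat \<Rightarrow> nat set"
  assumes "lacunar_listing n Q"
  shows "ga.alg_multiplicity (group_algebra n)
      (right_mult n (\<Sum>l = 1..n. ga_scale (lam l) (t_elem n l))) \<kappa>
    = (\<Sum>i | i \<in> {1..fib (n + 1)} \<and> g_val n lam Q i = \<kappa>. delta n Q i)"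
proof -
  define F where "F = right_mult n (\<Sum>l = 1..n. ga_scale (lam l) (t_elem n l))"
  define a where "a = (descent_sum n :: _ \<Rightarrow> _ \<Rightarrow> 'a)"
  let ?g = "\<lambda>w. g_val n lam Q (Qind n Q w)"
  obtain ws0 where "distinct ws0" "set ws0 = Sym n"
    using finite_distinct_list[of "Sym n"] by (auto simp: finite_permutations)
  then obtain ws where ws: "distinct ws" "set ws = Sym n" "sorted (map (Qind n Q) ws)"
    by (metis distinct_sort set_sort sorted_sort_key)
  have "ga.endo_char_poly (group_algebra n) F = (\<Prod>j\<leftarrow>[0..<length (map a ws)]. [:- ?g (ws ! j), 1:])"
  proof (rule ga.endo_char_poly_triangular)
    show "ga.ordered_basis (group_algebra n) (map a ws)"
      unfolding a_def by (rule descent_sum_basis[OF ws(1,2)])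
  next
    fix x :: "(nat \<Rightarrow> nat) \<Rightarrow> 'a" assume x: "x \<in> group_algebra n"
    have "ga.subspace (group_algebra n :: (_ \<Rightarrow> 'a) set)"
      by (auto simp: ga.subspace_def group_algebra_def ga_scale_def)
    then show "F x \<in> group_algebra n"
      unfolding F_def right_mult_shuffle[OF x]
      by (intro ga.subspace_sum ga.subspace_scale t_act_group_algebra[OF x]) auto
  next
    fix x y :: "(nat \<Rightarrow> nat) \<Rightarrow> 'a"
    show "F (x + y) = F x + F y"
      by (auto simp: F_def right_mult_def ga_mult_def fun_eq_iff case_prod_unfold distrib_right sum.distrib)
  next
    fix c and x :: "(nat \<Rightarrow> nat) \<Rightarrow> 'a"
    show "F (ga_scale c x) = ga_scale c (F x)"
      by (auto simp: F_def right_mult_def ga_mult_def ga_scale_def fun_eq_iff case_prod_unfold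
          sum_distrib_left mult.assoc)
  next
    fix j assume j: "j < length (map a ws)"
    have "a ` {v \<in> Sym n. Qind n Q v < Qind n Q (ws ! j)} \<subseteq> set (take j (map a ws))"
    proof
      fix x assume "x \<in> a ` {v \<in> Sym n. Qind n Q v < Qind n Q (ws ! j)}"
      then obtain v where v: "x = a v" "v \<in> set ws" "Qind n Q v < Qind n Q (ws ! j)"
        using ws(2) by auto
      then obtain i where i: "i < length ws" "v = ws ! i" by (auto simp: in_set_conv_nth)
      have "i < j"
      proof (rule ccontr)
        assume "\<not> i < j"
        then have "Qind n Q (ws ! j) \<le> Qind n Q (ws ! i)"
          using sorted_nth_mono[OF ws(3), of j i] i j by simp
        then show False using v i by simp
      qed
      then show "x \<in> set (take j (map a ws))"
        using v i j by (auto simp: take_map in_set_conv_nth intro!: image_eqI[of _ _ "ws ! i"] exI[of _ i])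
    qed
    moreover have "ws ! j \<in> Sym n" using ws(2) j nth_mem[of j ws] by simp
    ultimately have "F (a (ws ! j)) - ga_scale (?g (ws ! j)) (a (ws ! j))
        \<in> ga.span (set (take j (map a ws)))"
      using shuffle_triangular[OF assms, of "ws ! j" lam] ga.span_mono
      unfolding F_def a_def by blast
    then show "F (map a ws ! j) - ga_scale (?g (ws ! j)) (map a ws ! j)
        \<in> ga.span (set (take j (map a ws)))"
      using j by (simp only: length_map nth_map)
  qed
  also have "\<dots> = (\<Prod>w\<leftarrow>ws. [:- ?g w, 1:])"
    by (rule arg_cong[of _ _ prod_list], rule nth_equalityI) auto
  finally have "ga.alg_multiplicity (group_algebra n) F \<kappa> = length (filter (\<lambda>w. ?g w = \<kappa>) ws)"
    by (simp add: ga.alg_multiplicity_def order_prod_list_linear)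
  also have "\<dots> = card {w \<in> Sym n. ?g w = \<kappa>}"
    using ws distinct_card[of "filter (\<lambda>w. ?g w = \<kappa>) ws"] by simp
  also have "{w \<in> Sym n. ?g w = \<kappa>}
      = (\<Union>i\<in>{i. i \<in> {1..fib (n + 1)} \<and> g_val n lam Q i = \<kappa>}. {w \<in> Sym n. Qind n Q w = i})"
    using Qind_props(1)[OF assms] by auto
  also have "card \<dots> = (\<Sum>i | i \<in> {1..fib (n + 1)} \<and> g_val n lam Q i = \<kappa>. delta n Q i)"
    unfolding delta_def by (rule card_UN_disjoint) (auto simp: finite_permutations)
  finally show ?thesis unfolding F_def .
qed

end
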